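(* The configuration $O_6=(\ell_1^+,\ell_1^-,\ell_2^+,\ell_2^-,\ell_3^+,\ell_3^-)\in M^6$ is a point of sharp local maximum (modulo rotations) of the distance function $D$: there is a neighborhood $W$ of $O_6$ in $M^6$ such that for every $\mathbf m\in W$ which is not of the form $gO_6$ with $g\in SO(3)$, $$D(\mathbf m)<D(O_6).$$
   Context: Let $\mathbb S^2\subset\mathbb R^3$ be the unit sphere centered at the origin. $M$ is the manifold of unoriented straight lines tangent to $\mathbb S^2$; a point of $M$ is represented by a pair $(x,\xi)$ with $x\in\mathbb S^2$ the point of tangency and $\xi$ a unit tangent vector to $\mathbb S^2$ at $x$ giving the direction of the line, with $(x,\xi)$ and $(x,-\xi)$ identified (so $M$ is the quotient of the unit tangent bundle of $\mathbb S^2$ by $\xi\mapsto-\xi$, with the quotient topology and smooth structure). $M^6$ is the manifold of six-tuples of elements of $M$; $SO(3)$ acts on $M^6$ diagonally by rotating all the lines. For two lines $u,v$, $d_{u,v}$ is the Euclidean distance between them. The distance function on $M^6$ is $$D(u_1,\dots,u_6)=\min_{1\le i<j\le 6} d_{u_i,u_j}.$$ Let $e_1,e_2,e_3$ be the standard basis of $\mathbb R^3$. $\ell_1^{\pm}$ is the line tangent to $\mathbb S^2$ at $\pm e_1$ with direction $e_3$; $\ell_2^{\pm}$ is the line tangent at $\pm e_2$ with direction $e_1$; $\ell_3^{\pm}$ is the line tangent at $\pm e_3$ with direction $e_2$. The configuration $O_6$ is formed by these six lines. *)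

theory Defs
  imports "HOL-Analysis.Analysis"
begin

definition unit_tangent_bundle :: "((real^3) \<times> (real^3)) set" where
  "unit_tangent_bundle = {(x, \<xi>). norm x = 1 \<and> norm \<xi> = 1 \<and> x \<bullet> \<xi> = 0}"

fun line_of :: "(real^3) \<times> (real^3) \<Rightarrow> (real^3) set" where
  "line_of (x, \<xi>) = range (\<lambda>t. x + t *\<^sub>R \<xi>)"

definition tangent_lines :: "(real^3) set set" where
  "tangent_lines = line_of ` unit_tangent_bundle"

text \<open>
  Lines are represented as point sets. By \<open>line_of_eq_iff\<close> below, the fibres of \<open>line_of\<close>
  on the unit tangent bundle are exactly the classes of the identification
  \<open>(x, \<xi>) \<sim> (x, -\<xi>)\<close>, so the topology \<open>M\<close> on the set of tangent lines is that of the
  quotient of the unit tangent bundle by this identification.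
\<close>
definition M :: "(real^3) set topology" where
  "M = topology (\<lambda>U. U \<subseteq> tangent_lines \<and>
         openin (top_of_set unit_tangent_bundle) {p \<in> unit_tangent_bundle. line_of p \<in> U})"

definition M6 :: "(nat \<Rightarrow> (real^3) set) topology" where
  "M6 = product_topology (\<lambda>_. M) {1..6}"

definition rotate6 :: "real^3^3 \<Rightarrow> (nat \<Rightarrow> (real^3) set) \<Rightarrow> nat \<Rightarrow> (real^3) set" where
  "rotate6 g m = (\<lambda>i\<in>{1..6}. (\<lambda>p. g *v p) ` m i)"

definition D :: "(nat \<Rightarrow> (real^3) set) \<Rightarrow> real" where
  "D m = Min {setdist (m i) (m j) | i j. 1 \<le> i \<and> i < j \<and> j \<le> 6}"

abbreviation e1 :: "real^3" where "e1 \<equiv> axis 1 1"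
abbreviation e2 :: "real^3" where "e2 \<equiv> axis 2 1"
abbreviation e3 :: "real^3" where "e3 \<equiv> axis 3 1"

definition O6 :: "nat \<Rightarrow> (real^3) set" where
  "O6 = (\<lambda>i\<in>{1..6}.
     [line_of (e1, e3), line_of (- e1, e3),
      line_of (e2, e1), line_of (- e2, e1),
      line_of (e3, e2), line_of (- e3, e2)] ! (i - 1))"

lemma line_of_eq_iff:
  assumes "(x, \<xi>) \<in> unit_tangent_bundle" "(y, \<eta>) \<in> unit_tangent_bundle"
  shows "line_of (x, \<xi>) = line_of (y, \<eta>) \<longleftrightarrow> y = x \<and> (\<eta> = \<xi> \<or> \<eta> = - \<xi>)"
proof
  have n: "x \<bullet> x = 1" "\<xi> \<bullet> \<xi> = 1" "x \<bullet> \<xi> = 0" "y \<bullet> y = 1" "\<eta> \<bullet> \<eta> = 1" "y \<bullet> \<eta> = 0"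
    using assms by (auto simp: unit_tangent_bundle_def norm_eq_1)
  assume eq: "line_of (x, \<xi>) = line_of (y, \<eta>)"
  have "y + 0 *\<^sub>R \<eta> \<in> line_of (x, \<xi>)" "y + 1 *\<^sub>R \<eta> \<in> line_of (x, \<xi>)"
    unfolding eq by (simp_all only: line_of.simps) blast+
  then obtain s t where s: "y = x + s *\<^sub>R \<xi>" and t: "y + \<eta> = x + t *\<^sub>R \<xi>"
    unfolding line_of.simps scaleR_zero_left add_0_right scaleR_one by (elim rangeE)
  have "y \<bullet> y = 1 + s * s"
    using n by (simp add: s inner_add_left inner_add_right inner_commute)
  then have "s = 0" using n by simp
  with s have yx: "y = x" by simp
  with t have \<eta>: "\<eta> = t *\<^sub>R \<xi>" by simp
  then have "t * t = 1" using n by simp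
  then have "t = 1 \<or> t = -1" by (simp add: square_eq_1_iff)
  then show "y = x \<and> (\<eta> = \<xi> \<or> \<eta> = - \<xi>)" using yx \<eta> by auto
next
  have "range (\<lambda>t. x + t *\<^sub>R (- \<xi>)) = range (\<lambda>t. x + t *\<^sub>R \<xi>)"
  proof (intro subset_antisym subsetI; elim rangeE)
    fix p t assume "p = x + t *\<^sub>R (- \<xi>)"
    then have "p = x + (- t) *\<^sub>R \<xi>" by simp
    then show "p \<in> range (\<lambda>t. x + t *\<^sub>R \<xi>)" by blast
  next
    fix p t assume "p = x + t *\<^sub>R \<xi>"
    then have "p = x + (- t) *\<^sub>R (- \<xi>)" by simp
    then show "p \<in> range (\<lambda>t. x + t *\<^sub>R (- \<xi>))" by blast
  qed
  moreover assume "y = x \<and> (\<eta> = \<xi> \<or> \<eta> = - \<xi>)"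
  ultimately show "line_of (x, \<xi>) = line_of (y, \<eta>)" by (elim conjE disjE) (simp_all only: line_of.simps)
qed

lemma openin_M:
  "openin M U \<longleftrightarrow> U \<subseteq> tangent_lines \<and>
     openin (top_of_set unit_tangent_bundle) {p \<in> unit_tangent_bundle. line_of p \<in> U}"
proof -
  let ?P = "\<lambda>U. {p \<in> unit_tangent_bundle. line_of p \<in> U}"
  have "istopology (\<lambda>U. U \<subseteq> tangent_lines \<and> openin (top_of_set unit_tangent_bundle) (?P U))"
    unfolding istopology_def
  proof (intro conjI allI impI)
    fix S T :: "(real^3) set set"
    assume S: "S \<subseteq> tangent_lines \<and> openin (top_of_set unit_tangent_bundle) (?P S)"
      and T: "T \<subseteq> tangent_lines \<and> openin (top_of_set unit_tangent_bundle) (?P T)"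
    have "?P (S \<inter> T) = ?P S \<inter> ?P T" by auto
    then show "openin (top_of_set unit_tangent_bundle) (?P (S \<inter> T))"
      using openin_Int[of _ "?P S" "?P T"] S T by simp
    show "S \<inter> T \<subseteq> tangent_lines" using S by auto
  next
    fix K :: "(real^3) set set set"
    assume K: "\<forall>U\<in>K. U \<subseteq> tangent_lines \<and> openin (top_of_set unit_tangent_bundle) (?P U)"
    have "?P (\<Union>K) = \<Union>(?P ` K)" by auto
    moreover have "openin (top_of_set unit_tangent_bundle) (\<Union>(?P ` K))"
      using K by (intro openin_Union) blast
    ultimately show "openin (top_of_set unit_tangent_bundle) (?P (\<Union>K))" by (simp only:)
    show "\<Union>K \<subseteq> tangent_lines" using K by auto
  qed
  then show ?thesis
    by (simp add: M_def)
qed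

lemma topspace_M [simp]: "topspace M = tangent_lines"
proof -
  have "{p \<in> unit_tangent_bundle. line_of p \<in> tangent_lines} = unit_tangent_bundle"
    by (auto simp: tangent_lines_def)
  then have "openin M tangent_lines"
    by (simp add: openin_M)
  then show ?thesis
    using openin_subset[of M tangent_lines] openin_M[of "topspace M"] by auto
qed

lemma quotient_map_line_of: "quotient_map (top_of_set unit_tangent_bundle) M line_of"
  by (auto simp: quotient_map_def openin_M tangent_lines_def)

lemma O6_in_M6: "O6 \<in> topspace M6"
proof -
  have axes: "(s *\<^sub>R axis i 1, axis j 1) \<in> unit_tangent_bundle"
    if "i \<noteq> j" "\<bar>s\<bar> = 1" for i j :: 3 and s
    using that by (simp add: unit_tangent_bundle_def inner_axis_axis norm_axis_1)
  have "O6 i \<in> tangent_lines" if "i \<in> {1..6}" for i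
  proof -
    have "O6 i \<in> set [line_of (e1, e3), line_of (- e1, e3),
      line_of (e2, e1), line_of (- e2, e1), line_of (e3, e2), line_of (- e3, e2)]"
      using that unfolding O6_def restrict_apply
      by (simp only: if_True) (rule nth_mem, simp, linarith)
    moreover have "(e1, e3) \<in> unit_tangent_bundle" "(- e1, e3) \<in> unit_tangent_bundle"
      "(e2, e1) \<in> unit_tangent_bundle" "(- e2, e1) \<in> unit_tangent_bundle"
      "(e3, e2) \<in> unit_tangent_bundle" "(- e3, e2) \<in> unit_tangent_bundle"
      using axes[of 1 3 1] axes[of 1 3 "-1"] axes[of 2 1 1] axes[of 2 1 "-1"]
        axes[of 3 2 1] axes[of 3 2 "-1"] by simp_all
    ultimately show ?thesis
      unfolding tangent_lines_def by (auto simp del: line_of.simps)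
  qed
  then show ?thesis
    by (simp add: M6_def PiE_iff) (simp add: O6_def)
qed

end

theory Submission
  imports Defs
begin

text \<open>
  Every line of \<^term>\<open>O6\<close> is at distance at least \<open>1\<close> from the others, so it suffices to show that a
  configuration near \<^term>\<open>O6\<close> with all distances at least \<open>1\<close> is a rotated copy of \<^term>\<open>O6\<close>.

  Describe the line tangent at \<open>x\<close> with direction \<open>\<xi>\<close> by the orthonormal pair \<open>\<xi>\<close>, \<open>\<mu> = x \<times> \<xi>\<close>
  (its direction and its moment). Lines \<open>(\<xi>, \<mu>)\<close>, \<open>(\<xi>', \<mu>')\<close> at angle \<open>\<theta>\<close> and distance \<open>\<rho>\<close> satisfy
  \<open>\<bar>\<mu> \<bullet> \<xi>' + \<mu>' \<bullet> \<xi>\<bar> = \<rho> * sin \<theta>\<close>, so \<open>\<rho> \<ge> 1\<close> implies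
  \<open>(\<mu> \<bullet> \<xi>' + \<mu>' \<bullet> \<xi>)\<^sup>2 + (\<xi> \<bullet> \<xi>')\<^sup>2 \<ge> 1\<close> (\<open>distance_ge_1_imp_moment\<close>).

  The six lines form three antipodal pairs, indexed cyclically by \<open>k\<close>. In a pair with signs \<open>s = \<plusminus>1\<close> write
  \<open>\<xi> = B k + s *\<^sub>R N k\<close> and \<open>\<mu> = P k - s *\<^sub>R A k\<close>. At \<^term>\<open>O6\<close>, and at each rotated copy,
  \<open>P = N = 0\<close> and \<open>A (k+1) = B k\<close>, and \<open>B\<close> is orthonormal. The deviations \<open>P k\<close>, \<open>N k\<close> and
  \<open>A (k+1) - B k\<close> are rotation invariant in size, so working with them removes the rotations without
  choosing representatives.

  For consecutive pairs there are four constraints, one for each choice of signs. Their sum has no first-order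
  part in the deviations. Hence each constraint has to hold with equality to first order, which
  determines most of the deviations, and the sum then gives a quadratic inequality for the remaining six
  parameters \<open>b k\<close>, \<open>c k\<close>, namely \<open>(b k)\<^sup>2 + 2 * b k * b (k+1) + (c (k+2))\<^sup>2 \<le> 0\<close>. Adding the three
  inequalities gives \<open>(b 1 + b 2 + b 3)\<^sup>2 + (c 1)\<^sup>2 + (c 2)\<^sup>2 + (c 3)\<^sup>2 \<le> 0\<close>. No combination of them is positive
  definite, but together they have only the zero solution (\<open>limit_direction_zero\<close>). So the
  maximum is sharp although no single second-order test with multipliers proves it.

  This is turned into a proof by a blow-up: if there were nontrivial deviations of size \<open>r\<close> tending to \<open>0\<close>, the
  deviations divided by \<open>r\<close> would have a limit point of norm \<open>1\<close> satisfying exactly these relations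
  (\<open>blow_up_limit_zero\<close>, \<open>unit_apart_rigid\<close>). When all deviations vanish, the
  matrix with columns \<open>B (j+1)\<close> carries \<^term>\<open>O6\<close> to the configuration (\<open>rigid_frames_imp_rotation\<close>).
\<close>

section \<open>Mutual moments of tangent lines\<close>

text \<open>
  The left summand is \<open>(\<rho> * sin \<theta>)\<^sup>2\<close> and the right one \<open>(cos \<theta>)\<^sup>2\<close>, for the distance \<open>\<rho>\<close> and the
  angle \<open>\<theta>\<close> of the lines. In this form the parallel case causes no division by zero.
\<close>
lemma distance_ge_1_imp_moment:
  assumes "(x, \<xi>) \<in> unit_tangent_bundle" "(y, \<eta>) \<in> unit_tangent_bundle"
    and dist: "1 \<le> setdist (line_of (x, \<xi>)) (line_of (y, \<eta>))"
  shows "1 \<le> (cross3 x \<xi> \<bullet> \<eta> + cross3 y \<eta> \<bullet> \<xi>)\<^sup>2 + (\<xi> \<bullet> \<eta>)\<^sup>2"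
proof (cases "(\<xi> \<bullet> \<eta>)\<^sup>2 < 1")
  case False
  then show ?thesis by (meson add_increasing linorder_not_less zero_le_power2)
next
  case True
  have unit: "\<xi> \<bullet> \<xi> = 1" "\<eta> \<bullet> \<eta> = 1" "norm \<xi> = 1" "norm \<eta> = 1"
    using assms(1,2) by (auto simp: unit_tangent_bundle_def norm_eq_1)
  define u where "u = \<xi> \<bullet> \<eta>"
  define w where "w = x - y"
  define \<nu> where "\<nu> = cross3 \<xi> \<eta>"
  have pos: "1 - u\<^sup>2 > 0" using True by (simp add: u_def)
  \<comment> \<open>\<open>x + s *\<^sub>R \<xi>\<close> and \<open>y + t *\<^sub>R \<eta>\<close> are the feet of the common perpendicular of the two lines.\<close>
  define s where "s = (u * (w \<bullet> \<eta>) - w \<bullet> \<xi>) / (1 - u\<^sup>2)"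
  define t where "t = (w \<bullet> \<eta> - u * (w \<bullet> \<xi>)) / (1 - u\<^sup>2)"
  define v where "v = w + s *\<^sub>R \<xi> - t *\<^sub>R \<eta>"
  have "v \<bullet> \<xi> = w \<bullet> \<xi> + s - t * u"
    by (simp add: v_def u_def unit inner_diff_left inner_add_left inner_commute[of \<eta> \<xi>])
  also have "\<dots> = 0"
    using pos by (simp add: s_def t_def field_simps power2_eq_square)
  finally have v\<xi>: "v \<bullet> \<xi> = 0" .
  have "v \<bullet> \<eta> = w \<bullet> \<eta> + s * u - t"
    by (simp add: v_def u_def unit inner_diff_left inner_add_left)
  also have "\<dots> = 0"
    using pos by (simp add: s_def t_def field_simps power2_eq_square)
  finally have v\<eta>: "v \<bullet> \<eta> = 0" .
  have "1 \<le> dist (x + s *\<^sub>R \<xi>) (y + t *\<^sub>R \<eta>)"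
    by (rule order_trans[OF dist setdist_le_dist]) auto
  then have v1: "1 \<le> norm v"
    by (simp add: dist_norm v_def w_def algebra_simps)
  \<comment> \<open>The common perpendicular is parallel to \<open>\<xi> \<times> \<eta>\<close>, so no length is lost in projecting to it.\<close>
  have "cross3 v \<nu> = 0"
    unfolding \<nu>_def Lagrange v\<xi> v\<eta> by simp
  then have "(v \<bullet> \<nu>)\<^sup>2 = (norm v * norm \<nu>)\<^sup>2"
    using norm_cross_dot[of v \<nu>] by simp
  moreover have "(norm \<nu>)\<^sup>2 = 1 - u\<^sup>2"
    using norm_cross_dot[of \<xi> \<eta>] by (simp add: \<nu>_def u_def unit)
  moreover have "v \<bullet> \<nu> = w \<bullet> \<nu>"
    by (simp add: v_def \<nu>_def inner_diff_left inner_add_left dot_cross_self)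
  moreover have "w \<bullet> \<nu> = cross3 x \<xi> \<bullet> \<eta> + cross3 y \<eta> \<bullet> \<xi>"
    by (simp add: w_def \<nu>_def cross3_simps)
  ultimately have "(cross3 x \<xi> \<bullet> \<eta> + cross3 y \<eta> \<bullet> \<xi>)\<^sup>2 = (norm v)\<^sup>2 * (1 - u\<^sup>2)"
    by (simp add: power_mult_distrib)
  also have "\<dots> \<ge> 1 * (1 - u\<^sup>2)"
    using v1 pos by (intro mult_right_mono) auto
  finally show ?thesis by (simp add: u_def)
qed

section \<open>Antipodal pairs of lines\<close>

lemma cyclic_index:
  fixes k :: 3
  shows "k + 1 + 1 = k + 2" "k + 1 + 2 = k" "k + 2 + 1 = k" "k + 2 + 2 = k + 1"
proof -
  have "(3::3) = 0" by simp
  then show "k + 1 + 1 = k + 2" "k + 1 + 2 = k" "k + 2 + 1 = k" "k + 2 + 2 = k + 1"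
    by (simp_all add: add.assoc)
qed

text \<open>
  This says that \<open>P k - s *\<^sub>R A k\<close> and \<open>B k + s *\<^sub>R N k\<close> are orthonormal for \<open>s = 1\<close> and for \<open>s = -1\<close>: each
  condition is a half sum or half difference of those for the two signs.
\<close>
definition paired_frames ::
  "(3 \<Rightarrow> real^3) \<Rightarrow> (3 \<Rightarrow> real^3) \<Rightarrow> (3 \<Rightarrow> real^3) \<Rightarrow> (3 \<Rightarrow> real^3) \<Rightarrow> bool" where
  "paired_frames A B P N \<longleftrightarrow> (\<forall>k.
     P k \<bullet> P k + A k \<bullet> A k = 1 \<and> P k \<bullet> A k = 0 \<and>
     B k \<bullet> B k + N k \<bullet> N k = 1 \<and> B k \<bullet> N k = 0 \<and>
     P k \<bullet> B k = A k \<bullet> N k \<and> P k \<bullet> N k = A k \<bullet> B k)"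

text \<open>
  The mutual moment \<open>\<mu> \<bullet> \<xi>' + \<mu>' \<bullet> \<xi>\<close> of line \<open>s\<close> of pair \<open>k\<close> and line \<open>t\<close> of pair \<open>k + 1\<close>; the
  factor \<open>- t\<close> makes it equal to \<open>1\<close> at \<^term>\<open>O6\<close> for all four choices of signs.
\<close>
definition signed_moment ::
  "(3 \<Rightarrow> real^3) \<Rightarrow> (3 \<Rightarrow> real^3) \<Rightarrow> (3 \<Rightarrow> real^3) \<Rightarrow> (3 \<Rightarrow> real^3) \<Rightarrow> 3 \<Rightarrow> real \<Rightarrow> real \<Rightarrow> real" where
  "signed_moment A B P N k s t = - t * ((P k - s *\<^sub>R A k) \<bullet> (B (k+1) + t *\<^sub>R N (k+1))
      + (P (k+1) - t *\<^sub>R A (k+1)) \<bullet> (B k + s *\<^sub>R N k))"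

definition cosine :: "(3 \<Rightarrow> real^3) \<Rightarrow> (3 \<Rightarrow> real^3) \<Rightarrow> 3 \<Rightarrow> real \<Rightarrow> real \<Rightarrow> real" where
  "cosine B N k s t = (B k + s *\<^sub>R N k) \<bullet> (B (k+1) + t *\<^sub>R N (k+1))"

definition unit_apart ::
  "(3 \<Rightarrow> real^3) \<Rightarrow> (3 \<Rightarrow> real^3) \<Rightarrow> (3 \<Rightarrow> real^3) \<Rightarrow> (3 \<Rightarrow> real^3) \<Rightarrow> bool" where
  "unit_apart A B P N \<longleftrightarrow> (\<forall>k. \<forall>s\<in>{1,-1}. \<forall>t\<in>{1,-1}.
     1 \<le> (signed_moment A B P N k s t)\<^sup>2 + (cosine B N k s t)\<^sup>2)"

lemma paired_frames_from_lines:
  fixes x \<xi> :: "3 \<Rightarrow> real \<Rightarrow> real^3"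
  assumes utb: "\<And>k s. s \<in> {1,-1} \<Longrightarrow> (x k s, \<xi> k s) \<in> unit_tangent_bundle"
    and \<mu>: "\<And>k s. \<mu> k s = cross3 (x k s) (\<xi> k s)"
  shows "paired_frames (\<lambda>k. (1/2) *\<^sub>R (\<mu> k (-1) - \<mu> k 1)) (\<lambda>k. (1/2) *\<^sub>R (\<xi> k 1 + \<xi> k (-1)))
    (\<lambda>k. (1/2) *\<^sub>R (\<mu> k 1 + \<mu> k (-1))) (\<lambda>k. (1/2) *\<^sub>R (\<xi> k 1 - \<xi> k (-1)))"
proof -
  have "\<mu> k s \<bullet> \<mu> k s = 1 \<and> \<xi> k s \<bullet> \<xi> k s = 1 \<and> \<mu> k s \<bullet> \<xi> k s = 0 \<and> \<xi> k s \<bullet> \<mu> k s = 0"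
    if "s \<in> {1,-1}" for k s
  proof -
    have n: "norm (x k s) = 1" "norm (\<xi> k s) = 1" "x k s \<bullet> \<xi> k s = 0"
      using utb[OF that, of k] by (auto simp: unit_tangent_bundle_def)
    then have "(norm (\<mu> k s))\<^sup>2 = 1"
      using norm_cross_dot[of "x k s" "\<xi> k s"] by (simp add: \<mu>)
    then have "norm (\<mu> k s) = 1" by (metis norm_ge_zero power2_eq_1_iff neg_0_le_iff_le not_one_le_zero)
    then show ?thesis using n by (simp add: norm_eq_1 \<mu> dot_cross_self)
  qed
  from this[of 1] this[of "-1"] show ?thesis
    by (simp add: paired_frames_def inner_add_left inner_add_right inner_diff_left inner_diff_right
      inner_commute[of "\<mu> _ (- 1)" "\<mu> _ 1"] inner_commute[of "\<xi> _ (- 1)" "\<xi> _ 1"])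
      (simp add: field_simps)
qed

lemma unit_apart_from_lines:
  fixes x \<xi> :: "3 \<Rightarrow> real \<Rightarrow> real^3"
  assumes utb: "\<And>k s. s \<in> {1,-1} \<Longrightarrow> (x k s, \<xi> k s) \<in> unit_tangent_bundle"
    and \<mu>: "\<And>k s. \<mu> k s = cross3 (x k s) (\<xi> k s)"
    and dist: "\<And>k s t. s \<in> {1,-1} \<Longrightarrow> t \<in> {1,-1} \<Longrightarrow>
      1 \<le> setdist (line_of (x k s, \<xi> k s)) (line_of (x (k+1) t, \<xi> (k+1) t))"
  shows "unit_apart (\<lambda>k. (1/2) *\<^sub>R (\<mu> k (-1) - \<mu> k 1)) (\<lambda>k. (1/2) *\<^sub>R (\<xi> k 1 + \<xi> k (-1)))
    (\<lambda>k. (1/2) *\<^sub>R (\<mu> k 1 + \<mu> k (-1))) (\<lambda>k. (1/2) *\<^sub>R (\<xi> k 1 - \<xi> k (-1)))"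
proof -
  have half: "(1/2) *\<^sub>R (a + b) + (1/2) *\<^sub>R (a - b) = a" "(1/2) *\<^sub>R (a + b) - (1/2) *\<^sub>R (a - b) = b"
    "(1/2) *\<^sub>R (a + b) - (1/2) *\<^sub>R (b - a) = a" "(1/2) *\<^sub>R (a + b) + (1/2) *\<^sub>R (b - a) = b" for a b :: "real^3"
    by (simp_all add: scaleR_add_right[symmetric] scaleR_diff_right[symmetric] scaleR_2[symmetric])
  have "1 \<le> (- t * (\<mu> k s \<bullet> \<xi> (k+1) t + \<mu> (k+1) t \<bullet> \<xi> k s))\<^sup>2 + (\<xi> k s \<bullet> \<xi> (k+1) t)\<^sup>2"
    if "s \<in> {1,-1}" "t \<in> {1,-1}" for k s t
  proof -
    have "(- t * a)\<^sup>2 = a\<^sup>2" for a :: real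
      using that(2) by auto
    then show ?thesis
      using distance_ge_1_imp_moment[OF utb[OF that(1)] utb[OF that(2)] dist[OF that]]
      by (simp only: \<mu>)
  qed
  moreover have "(1/2) *\<^sub>R (\<mu> k 1 + \<mu> k (-1)) - s *\<^sub>R (1/2) *\<^sub>R (\<mu> k (-1) - \<mu> k 1) = \<mu> k s"
    and "(1/2) *\<^sub>R (\<xi> k 1 + \<xi> k (-1)) + s *\<^sub>R (1/2) *\<^sub>R (\<xi> k 1 - \<xi> k (-1)) = \<xi> k s"
    if "s \<in> {1,-1}" for k s
    using that by (auto simp: half)
  ultimately show ?thesis
    unfolding unit_apart_def signed_moment_def cosine_def by (intro allI ballI) (simp only:)
qed

section \<open>First and second order conditions at the configuration\<close>

text \<open>
  The algebra behind sharpness. By the linear relations the deviations are given by \<open>b k = n k $ (k + 1)\<close> and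
  \<open>c k = d k $ k\<close>, and \<open>quad\<close> becomes \<open>(b k)\<^sup>2 + 2 * b k * b (k+1) + (c (k+2))\<^sup>2 \<le> 0\<close>.
\<close>
lemma limit_direction_zero:
  fixes p n d :: "3 \<Rightarrow> real^3"
  assumes p1: "\<And>k. p k $ (k + 1) = 0" and p0: "\<And>k. p k $ k = 0"
    and n2: "\<And>k. n k $ (k + 2) = 0" and n0: "\<And>k. n k $ k = 0"
    and pn: "\<And>k. p k $ (k + 2) = n k $ (k + 1)"
    and d2: "\<And>k. d k $ (k + 2) = 0"
    and dd: "\<And>k. d k $ (k + 1) = d (k + 2) $ (k + 2)"
    and quad: "\<And>k. p (k+1) \<bullet> p (k+1) + n k \<bullet> n k + d k \<bullet> d k + 2 * (p k \<bullet> n (k+1))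
        \<le> (d k $ k)\<^sup>2 + (n (k+1) $ (k+2))\<^sup>2 + (n k $ k)\<^sup>2"
  shows "p k = 0 \<and> n k = 0 \<and> d k = 0"
proof -
  have num: "(4::3) = 1" "(5::3) = 2" by simp_all
  define b where "b k = n k $ (k + 1)" for k
  define c where "c k = d k $ k" for k
  have inner: "v \<bullet> w = v $ k * w $ k + v $ (k+1) * w $ (k+1) + v $ (k+2) * w $ (k+2)"
    for v w :: "real^3" and k
    using exhaust_3[of k] by (auto simp: inner_vec_def sum_3 num)
  have pk: "p k $ k = 0" "p k $ (k+1) = 0" "p k $ (k+2) = b k" for k
    using p0 p1 pn by (simp_all add: b_def)
  have nk: "n k $ k = 0" "n k $ (k+1) = b k" "n k $ (k+2) = 0" for k
    using n0 n2 by (simp_all add: b_def)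
  have dk: "d k $ k = c k" "d k $ (k+1) = c (k+2)" "d k $ (k+2) = 0" for k
    using d2 dd by (simp_all add: c_def)
  have "b k * b k + 2 * (b k * b (k+1)) + c (k+2) * c (k+2) \<le> 0" for k
    using quad[of k] pk[of k] nk[of k] dk[of k] nk[of "k+1"] pk[of "k+1"]
    unfolding inner[of _ _ k] by (simp add: cyclic_index power2_eq_square)
  from this[of 1] this[of 2] this[of 3]
  have "(b 1 + b 2 + b 3)\<^sup>2 + (c 1)\<^sup>2 + (c 2)\<^sup>2 + (c 3)\<^sup>2 \<le> 0"
    and q: "b 1 * b 1 + 2 * (b 1 * b 2) + c 3 * c 3 \<le> 0"
      "b 2 * b 2 + 2 * (b 2 * b 3) + c 1 * c 1 \<le> 0"
      "b 3 * b 3 + 2 * (b 3 * b 1) + c 2 * c 2 \<le> 0"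
    by (simp_all add: num power2_eq_square algebra_simps)
  moreover have "0 \<le> (b 1 + b 2 + b 3)\<^sup>2" "0 \<le> (c 1)\<^sup>2" "0 \<le> (c 2)\<^sup>2" "0 \<le> (c 3)\<^sup>2"
    by simp_all
  ultimately have "(b 1 + b 2 + b 3)\<^sup>2 = 0" "(c 1)\<^sup>2 = 0" "(c 2)\<^sup>2 = 0" "(c 3)\<^sup>2 = 0"
    by linarith+
  then have c0: "c 1 = 0" "c 2 = 0" "c 3 = 0" and s0: "b 1 + b 2 + b 3 = 0"
    by simp_all
  \<comment> \<open>The sum of the three forms vanishes on the plane \<open>b 1 + b 2 + b 3 = 0\<close>; on that plane
      the separate inequalities force each form to vanish, and they have no common zero but \<open>0\<close>.\<close>
  have "b 1 = 0 \<and> b 2 = 0 \<and> b 3 = 0"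
  proof -
    have b3: "b 3 = - b 1 - b 2" using s0 by simp
    have e: "b 1 * (b 1 + 2 * b 2) = 0" "b 2 * (b 2 + 2 * b 1) = 0"
      using q s0 c0 unfolding b3 by (auto simp: algebra_simps)
    then show ?thesis using b3 by auto
  qed
  then have "b k = 0" "c k = 0" for k
    using c0 exhaust_3[of k] by auto
  then have "v $ k = 0 \<and> v $ (k+1) = 0 \<and> v $ (k+2) = 0" if "v = p k \<or> v = n k \<or> v = d k" for v
    using that pk nk dk by auto
  moreover have "v = 0" if "v $ k = 0 \<and> v $ (k+1) = 0 \<and> v $ (k+2) = 0" for v :: "real^3"
    using that inner[of v v k] by simp
  ultimately show ?thesis by blast
qed

text \<open>
  Expansion in the size \<open>r\<close> of the deviations. The first-order part changes sign with \<open>s\<close> or \<open>t\<close>, so it cancels when the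
  four moments are added, and what remains of the sum has order \<open>r\<^sup>2\<close>. The identity is exact because \<open>A (k+1) \<bullet> B k\<close> is
  determined by the lengths of \<open>A (k+1)\<close>, \<open>B k\<close> and their difference.
\<close>
lemma signed_moment_rescaled:
  fixes A B P N D :: "3 \<Rightarrow> real^3"
  assumes frames: "paired_frames A B (\<lambda>k. r *\<^sub>R P k) (\<lambda>k. r *\<^sub>R N k)"
    and AB: "A (k+1) = B k + r *\<^sub>R D k" and "r \<noteq> 0"
    and s: "s * s = 1" and t: "t * t = 1"
  shows "signed_moment A B (\<lambda>k. r *\<^sub>R P k) (\<lambda>k. r *\<^sub>R N k) k s t =
    1 - r\<^sup>2 / 2 * (P (k+1) \<bullet> P (k+1) + N k \<bullet> N k + D k \<bullet> D k + 2 * (P k \<bullet> N (k+1)))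
    + r * (s * (A k \<bullet> N (k+1) + A (k+1) \<bullet> N k) - t * (P k \<bullet> B (k+1) + P (k+1) \<bullet> B k)
       + s * t * (A k \<bullet> B (k+1) / r - r * (P (k+1) \<bullet> N k)))"
proof -
  have a: "A (k+1) \<bullet> A (k+1) = 1 - r\<^sup>2 * (P (k+1) \<bullet> P (k+1))"
    and b: "B k \<bullet> B k = 1 - r\<^sup>2 * (N k \<bullet> N k)"
    using frames by (simp_all add: paired_frames_def power2_eq_square algebra_simps)
  have d: "r *\<^sub>R D k = A (k+1) - B k" using AB by simp
  have "r\<^sup>2 * (D k \<bullet> D k) = (r *\<^sub>R D k) \<bullet> (r *\<^sub>R D k)" by (simp add: power2_eq_square)
  also have "\<dots> = A (k+1) \<bullet> A (k+1) + B k \<bullet> B k - 2 * (A (k+1) \<bullet> B k)"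
    unfolding d by (simp add: inner_diff inner_commute)
  finally have ab: "A (k+1) \<bullet> B k = 1 - r\<^sup>2 / 2 * (P (k+1) \<bullet> P (k+1) + N k \<bullet> N k + D k \<bullet> D k)"
    using a b by (simp add: algebra_simps)
  have "signed_moment A B (\<lambda>k. r *\<^sub>R P k) (\<lambda>k. r *\<^sub>R N k) k s t =
    A (k+1) \<bullet> B k * (t * t) - r\<^sup>2 * (P k \<bullet> N (k+1)) * (t * t)
    + r * (s * (A k \<bullet> N (k+1) * (t * t) + A (k+1) \<bullet> N k * (t * t)) - t * (P k \<bullet> B (k+1) + P (k+1) \<bullet> B k)
       + s * t * (A k \<bullet> B (k+1) / r - r * (P (k+1) \<bullet> N k)))"
    using \<open>r \<noteq> 0\<close>
    by (simp add: signed_moment_def inner_add_left inner_add_right inner_diff_left power2_eq_square algebra_simps)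
  then show ?thesis unfolding t ab by (simp add: algebra_simps)
qed

text \<open>
  These products vanish to first order because \<open>A (k+1)\<close>, which is close to \<open>B k\<close>, is nearly orthogonal to \<open>B (k+1)\<close>.
\<close>
lemma direction_products_rescaled:
  fixes A B P N D :: "3 \<Rightarrow> real^3"
  assumes frames: "paired_frames A B (\<lambda>k. r *\<^sub>R P k) (\<lambda>k. r *\<^sub>R N k)"
    and AB: "\<And>k. A (k+1) = B k + r *\<^sub>R D k"
  shows "B k \<bullet> B (k+1) = r * (r * (P (k+1) \<bullet> N (k+1)) - D k \<bullet> B (k+1))"
    and "A k \<bullet> B (k+1) = r * (D (k+2) \<bullet> B (k+1) - D (k+1) \<bullet> B (k+2) + r * (P (k+2) \<bullet> N (k+2)))"
proof -
  have *: "B k \<bullet> B (k+1) = r * (r * (P (k+1) \<bullet> N (k+1)) - D k \<bullet> B (k+1))" for k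
  proof -
    have "A (k+1) \<bullet> B (k+1) = B k \<bullet> B (k+1) + r * (D k \<bullet> B (k+1))"
      by (simp only: AB[of k] inner_add_left inner_scaleR_left)
    moreover have "A (k+1) \<bullet> B (k+1) = r * (r * (P (k+1) \<bullet> N (k+1)))"
      using frames by (simp add: paired_frames_def)
    ultimately show ?thesis by (simp add: algebra_simps)
  qed
  show "B k \<bullet> B (k+1) = r * (r * (P (k+1) \<bullet> N (k+1)) - D k \<bullet> B (k+1))" by (rule *)
  have "A k = B (k+2) + r *\<^sub>R D (k+2)" using AB[of "k+2"] by (simp only: cyclic_index)
  moreover have "B (k+1) \<bullet> B (k+2) = r * (r * (P (k+2) \<bullet> N (k+2)) - D (k+1) \<bullet> B (k+2))"
    using *[of "k+1"] by (simp only: cyclic_index)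
  ultimately show "A k \<bullet> B (k+1) = r * (D (k+2) \<bullet> B (k+1) - D (k+1) \<bullet> B (k+2) + r * (P (k+2) \<bullet> N (k+2)))"
    by (simp add: inner_add_left inner_commute algebra_simps)
qed

text \<open>
  Passing to the limit in the exact relations divided by \<open>r\<close>, and in the sums of moments divided by \<open>r\<^sup>2\<close>,
  yields the hypotheses of \<open>limit_direction_zero\<close>.
\<close>
lemma blow_up_limit_zero:
  fixes A B P N D :: "nat \<Rightarrow> 3 \<Rightarrow> real^3" and r :: "nat \<Rightarrow> real" and p n d :: "3 \<Rightarrow> real^3"
  assumes frames: "\<And>i. paired_frames (A i) (B i) (\<lambda>k. r i *\<^sub>R P i k) (\<lambda>k. r i *\<^sub>R N i k)"
    and apart: "\<And>i. unit_apart (A i) (B i) (\<lambda>k. r i *\<^sub>R P i k) (\<lambda>k. r i *\<^sub>R N i k)"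
    and AB: "\<And>i k. A i (k+1) = B i k + r i *\<^sub>R D i k"
    and r_pos: "\<And>i. r i > 0" and r: "r \<longlonglongrightarrow> 0"
    and B: "\<And>k. (\<lambda>i. B i k) \<longlonglongrightarrow> axis (k+2) 1"
    and P: "\<And>k. (\<lambda>i. P i k) \<longlonglongrightarrow> p k" and N: "\<And>k. (\<lambda>i. N i k) \<longlonglongrightarrow> n k"
    and D: "\<And>k. (\<lambda>i. D i k) \<longlonglongrightarrow> d k"
  shows "p k = 0 \<and> n k = 0 \<and> d k = 0"
proof -
  have A': "(\<lambda>i. A i (k+1)) \<longlonglongrightarrow> axis (k+2) 1" for k
  proof -
    have "(\<lambda>i. B i k + r i *\<^sub>R D i k) \<longlonglongrightarrow> axis (k+2) 1 + 0 *\<^sub>R d k"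
      by (intro tendsto_intros r B D)
    then show ?thesis by (simp add: AB)
  qed
  have A: "(\<lambda>i. A i k) \<longlonglongrightarrow> axis (k+1) 1" for k
    using A'[of "k+2"] by (simp only: cyclic_index)
  have fr: "r i * (r i * (P i k \<bullet> P i k)) + A i k \<bullet> A i k = 1" "P i k \<bullet> A i k = 0"
     "B i k \<bullet> B i k + r i * (r i * (N i k \<bullet> N i k)) = 1" "B i k \<bullet> N i k = 0"
     "P i k \<bullet> B i k = A i k \<bullet> N i k" for i k
    using frames[of i] r_pos[of i] by (simp_all add: paired_frames_def less_le)
  note lims = tendsto_intros r A B P N D
  have ax: "v \<bullet> axis j 1 = v $ j" "axis j 1 \<bullet> v = v $ j" for v :: "real^3" and j
    by (simp_all add: inner_axis inner_axis')
  have p1: "p k $ (k+1) = 0" for k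
  proof -
    have "(\<lambda>i. P i k \<bullet> A i k) \<longlonglongrightarrow> p k \<bullet> axis (k+1) 1" by (intro lims)
    then show ?thesis by (simp add: fr ax LIMSEQ_const_iff)
  qed
  have n2: "n k $ (k+2) = 0" for k
  proof -
    have "(\<lambda>i. B i k \<bullet> N i k) \<longlonglongrightarrow> axis (k+2) 1 \<bullet> n k" by (intro lims)
    then show ?thesis by (simp add: fr ax LIMSEQ_const_iff)
  qed
  have pn: "p k $ (k+2) = n k $ (k+1)" for k
  proof -
    have "(\<lambda>i. P i k \<bullet> B i k) \<longlonglongrightarrow> p k \<bullet> axis (k+2) 1" by (intro lims)
    moreover have "(\<lambda>i. A i k \<bullet> N i k) \<longlonglongrightarrow> axis (k+1) 1 \<bullet> n k" by (intro lims)
    ultimately show ?thesis by (simp add: fr ax LIMSEQ_unique)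
  qed
  \<comment> \<open>\<open>A i (k+1)\<close> and \<open>B i k\<close> both have length \<open>1 + O((r i)\<^sup>2)\<close>, so their difference is orthogonal to them to first order.\<close>
  have d2: "d k $ (k+2) = 0" for k
  proof -
    have "D i k \<bullet> (A i (k+1) + B i k) = r i * (N i k \<bullet> N i k - P i (k+1) \<bullet> P i (k+1))" for i
    proof -
      have "r i * (D i k \<bullet> (A i (k+1) + B i k)) = (A i (k+1) - B i k) \<bullet> (A i (k+1) + B i k)"
        by (simp add: AB)
      also have "\<dots> = A i (k+1) \<bullet> A i (k+1) - B i k \<bullet> B i k"
        by (simp add: inner_diff inner_add_right inner_commute)
      also have "\<dots> = r i * (r i * (N i k \<bullet> N i k - P i (k+1) \<bullet> P i (k+1)))"
        using fr(1)[of i "k+1"] fr(3)[of i k] by (simp add: algebra_simps)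
      finally show ?thesis using r_pos[of i] by simp
    qed
    moreover have "(\<lambda>i. D i k \<bullet> (A i (k+1) + B i k)) \<longlonglongrightarrow> d k \<bullet> (axis (k+2) 1 + axis (k+2) 1)"
      by (intro lims A')
    moreover have "(\<lambda>i. r i * (N i k \<bullet> N i k - P i (k+1) \<bullet> P i (k+1)))
        \<longlonglongrightarrow> 0 * (n k \<bullet> n k - p (k+1) \<bullet> p (k+1))"
      by (intro lims)
    ultimately have "d k \<bullet> (axis (k+2) 1 + axis (k+2) 1) = 0 * (n k \<bullet> n k - p (k+1) \<bullet> p (k+1))"
      by (simp only: LIMSEQ_unique)
    then show ?thesis by (simp only: inner_add_right ax)
  qed

  \<comment> \<open>The moment is \<open>h = 1 - r\<^sup>2 / 2 * E + r * L\<close> and the cosine is \<open>r * U\<close>, where \<open>L\<close> has no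
      term independent of the signs \<open>s\<close>, \<open>t\<close> and therefore sums to zero over them.\<close>
  define S where "S i k = A i k \<bullet> N i (k+1) + A i (k+1) \<bullet> N i k" for i k
  define T where "T i k = P i k \<bullet> B i (k+1) + P i (k+1) \<bullet> B i k" for i k
  define V where "V i k = D i (k+2) \<bullet> B i (k+1) - D i (k+1) \<bullet> B i (k+2)
      + r i * (P i (k+2) \<bullet> N i (k+2)) - r i * (P i (k+1) \<bullet> N i k)" for i k
  define L where "L i k s t = s * S i k - t * T i k + s * t * V i k" for i k s t
  define E where "E i k = P i (k+1) \<bullet> P i (k+1) + N i k \<bullet> N i k + D i k \<bullet> D i k
      + 2 * (P i k \<bullet> N i (k+1))" for i k
  define U where "U i k s t = r i * (P i (k+1) \<bullet> N i (k+1)) - D i k \<bullet> B i (k+1)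
      + t * (B i k \<bullet> N i (k+1)) + s * (N i k \<bullet> B i (k+1)) + s * t * r i * (N i k \<bullet> N i (k+1))"
    for i k s t
  define h where "h i k s t = 1 - (r i)\<^sup>2 / 2 * E i k + r i * L i k s t" for i k s t
  have off: "signed_moment (A i) (B i) (\<lambda>k. r i *\<^sub>R P i k) (\<lambda>k. r i *\<^sub>R N i k) k s t = h i k s t"
    if "s \<in> {1,-1}" "t \<in> {1,-1}" for i k s t
  proof -
    have st: "s * s = 1" "t * t = 1" using that by auto
    have "r i \<noteq> 0" using r_pos[of i] by simp
    then have V: "V i k = A i k \<bullet> B i (k+1) / r i - r i * (P i (k+1) \<bullet> N i k)"
      by (simp add: V_def direction_products_rescaled(2)[OF frames AB])
    have "signed_moment (A i) (B i) (\<lambda>k. r i *\<^sub>R P i k) (\<lambda>k. r i *\<^sub>R N i k) k s t =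
        1 - (r i)\<^sup>2 / 2 * E i k + r i * (s * S i k - t * T i k
          + s * t * (A i k \<bullet> B i (k+1) / r i - r i * (P i (k+1) \<bullet> N i k)))"
      unfolding E_def S_def T_def by (rule signed_moment_rescaled[OF frames AB \<open>r i \<noteq> 0\<close> st])
    then show ?thesis by (simp only: h_def L_def V)
  qed
  have cos: "cosine (B i) (\<lambda>k. r i *\<^sub>R N i k) k s t = r i * U i k s t" for i k s t
    using direction_products_rescaled(1)[OF frames AB, of i k]
    by (simp add: cosine_def U_def inner_add_left inner_add_right algebra_simps)
  \<comment> \<open>This is \<open>1 - h\<^sup>2 \<le> (r * U)\<^sup>2\<close> divided by \<open>r\<close>; dividing by \<open>r\<close> again gives the second-order
      information.\<close>
  have key: "(r i / 2 * E i k - L i k s t) * (1 + h i k s t) \<le> r i * (U i k s t)\<^sup>2"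
    if "s \<in> {1,-1}" "t \<in> {1,-1}" for i k s t
  proof -
    have "1 \<le> (h i k s t)\<^sup>2 + (r i * U i k s t)\<^sup>2"
      using apart[of i, unfolded unit_apart_def, rule_format, OF that, of k]
      by (simp only: off[OF that] cos)
    then have "(1 - h i k s t) * (1 + h i k s t) \<le> r i * (r i * (U i k s t)\<^sup>2)"
      by (simp add: power2_eq_square algebra_simps)
    moreover have "1 - h i k s t = r i * (r i / 2 * E i k - L i k s t)"
      by (simp add: h_def power2_eq_square algebra_simps)
    ultimately show ?thesis using r_pos[of i] by (simp add: mult.assoc)
  qed

  define e where "e k = p (k+1) \<bullet> p (k+1) + n k \<bullet> n k + d k \<bullet> d k + 2 * (p k \<bullet> n (k+1))" for k
  define u where "u k s t = t * (n (k+1) $ (k+2)) + s * (n k $ k) - d k $ k" for k s t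
  have E: "(\<lambda>i. E i k) \<longlonglongrightarrow> e k" for k
    unfolding E_def e_def by (intro lims)
  have S: "(\<lambda>i. S i k) \<longlonglongrightarrow> n (k+1) $ (k+1)" for k
  proof -
    have "(\<lambda>i. S i k) \<longlonglongrightarrow> axis (k+1) 1 \<bullet> n (k+1) + axis (k+2) 1 \<bullet> n k"
      unfolding S_def by (intro lims A')
    then show ?thesis by (simp add: ax n2)
  qed
  have T: "(\<lambda>i. T i k) \<longlonglongrightarrow> p k $ k" for k
  proof -
    have "(\<lambda>i. T i k) \<longlonglongrightarrow> p k \<bullet> axis (k+1+2) 1 + p (k+1) \<bullet> axis (k+2) 1"
      unfolding T_def by (intro lims)
    moreover have "p (k+1) $ (k+2) = 0" using p1[of "k+1"] by (simp only: cyclic_index)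
    ultimately show ?thesis by (simp only: ax cyclic_index) simp
  qed
  have V: "(\<lambda>i. V i k) \<longlonglongrightarrow> d (k+2) $ k - d (k+1) $ (k+1)" for k
  proof -
    have "(\<lambda>i. V i k) \<longlonglongrightarrow> d (k+2) \<bullet> axis (k+1+2) 1 - d (k+1) \<bullet> axis (k+2+2) 1
        + 0 * (p (k+2) \<bullet> n (k+2)) - 0 * (p (k+1) \<bullet> n k)"
      unfolding V_def by (intro lims)
    then show ?thesis by (simp only: ax cyclic_index) simp
  qed
  have L: "(\<lambda>i. L i k s t) \<longlonglongrightarrow>
      s * n (k+1) $ (k+1) - t * p k $ k + s * t * (d (k+2) $ k - d (k+1) $ (k+1))" for k s t
    unfolding L_def by (intro tendsto_intros S T V)
  have U: "(\<lambda>i. U i k s t) \<longlonglongrightarrow> u k s t" for k s t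
  proof -
    have "(\<lambda>i. U i k s t) \<longlonglongrightarrow> 0 * (p (k+1) \<bullet> n (k+1)) - d k \<bullet> axis (k+1+2) 1
       + t * (axis (k+2) 1 \<bullet> n (k+1)) + s * (n k \<bullet> axis (k+1+2) 1) + s * t * 0 * (n k \<bullet> n (k+1))"
      unfolding U_def by (intro lims)
    then show ?thesis by (simp only: ax cyclic_index u_def) (simp add: algebra_simps)
  qed
  have h: "(\<lambda>i. h i k s t) \<longlonglongrightarrow> 1" for k s t
  proof -
    have "(\<lambda>i. h i k s t) \<longlonglongrightarrow> 1 - 0\<^sup>2 / 2 * e k
      + 0 * (s * n (k+1) $ (k+1) - t * p k $ k + s * t * (d (k+2) $ k - d (k+1) $ (k+1)))"
      unfolding h_def by (intro tendsto_intros r E L) simp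
    then show ?thesis by simp
  qed
  \<comment> \<open>First order: the limit of \<open>L\<close> is nonnegative for all four choices of signs, and these sum to zero.\<close>
  have first: "0 \<le> s * n (k+1) $ (k+1) - t * p k $ k + s * t * (d (k+2) $ k - d (k+1) $ (k+1))"
    (is "0 \<le> ?l") if "s \<in> {1,-1}" "t \<in> {1,-1}" for k s t
  proof -
    have "(\<lambda>i. (r i / 2 * E i k - L i k s t) * (1 + h i k s t)) \<longlonglongrightarrow> (0 / 2 * e k - ?l) * (1 + 1)"
      by (intro tendsto_intros r E L h) simp
    moreover have "(\<lambda>i. r i * (U i k s t)\<^sup>2) \<longlonglongrightarrow> 0 * (u k s t)\<^sup>2"
      by (intro tendsto_intros r U)
    ultimately have "(0 / 2 * e k - ?l) * (1 + 1) \<le> 0 * (u k s t)\<^sup>2"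
      using key[OF that] by (intro LIMSEQ_le) auto
    then show ?thesis by simp
  qed
  have n0: "n (k+1) $ (k+1) = 0" and p0: "p k $ k = 0" and dd: "d (k+2) $ k = d (k+1) $ (k+1)" for k
    using first[of 1 1 k] first[of 1 "-1" k] first[of "-1" 1 k] first[of "-1" "-1" k] by simp_all
  \<comment> \<open>Second order: summing over the signs removes \<open>L\<close>, so that the sum can be divided by \<open>r\<close> once more.\<close>
  have quad: "e k \<le> (d k $ k)\<^sup>2 + (n (k+1) $ (k+2))\<^sup>2 + (n k $ k)\<^sup>2" for k
  proof -
    have ev: "\<forall>\<^sub>F i in sequentially. 0 < 1 + h i k s t" for s t
    proof -
      have "\<forall>\<^sub>F i in sequentially. 0 < h i k s t" by (rule order_tendstoD(1)[OF h]) simp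
      then show ?thesis by eventually_elim simp
    qed
    have "\<forall>\<^sub>F i in sequentially. 2 * E i k \<le> (U i k 1 1)\<^sup>2 / (1 + h i k 1 1) + (U i k 1 (-1))\<^sup>2 / (1 + h i k 1 (-1))
       + (U i k (-1) 1)\<^sup>2 / (1 + h i k (-1) 1) + (U i k (-1) (-1))\<^sup>2 / (1 + h i k (-1) (-1))"
      using ev[of 1 1] ev[of 1 "-1"] ev[of "-1" 1] ev[of "-1" "-1"]
    proof eventually_elim
      case (elim i)
      have each: "r i / 2 * E i k - L i k s t \<le> r i * ((U i k s t)\<^sup>2 / (1 + h i k s t))"
        if "s \<in> {1,-1}" "t \<in> {1,-1}" "0 < 1 + h i k s t" for s t
        using key[OF that(1,2), of i k] that(3) by (simp add: pos_le_divide_eq)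
      have "r i * (2 * E i k) \<le> r i * ((U i k 1 1)\<^sup>2 / (1 + h i k 1 1) + (U i k 1 (-1))\<^sup>2 / (1 + h i k 1 (-1))
       + (U i k (-1) 1)\<^sup>2 / (1 + h i k (-1) 1) + (U i k (-1) (-1))\<^sup>2 / (1 + h i k (-1) (-1)))"
        using each[of 1 1] each[of 1 "-1"] each[of "-1" 1] each[of "-1" "-1"] elim
        by (simp add: L_def distrib_left)
      then show ?case using r_pos[of i] by simp
    qed
    moreover have "(\<lambda>i. 2 * E i k) \<longlonglongrightarrow> 2 * e k" by (intro tendsto_intros E)
    moreover have "(\<lambda>i. (U i k 1 1)\<^sup>2 / (1 + h i k 1 1) + (U i k 1 (-1))\<^sup>2 / (1 + h i k 1 (-1))
       + (U i k (-1) 1)\<^sup>2 / (1 + h i k (-1) 1) + (U i k (-1) (-1))\<^sup>2 / (1 + h i k (-1) (-1)))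
       \<longlonglongrightarrow> (u k 1 1)\<^sup>2 / (1 + 1) + (u k 1 (-1))\<^sup>2 / (1 + 1)
         + (u k (-1) 1)\<^sup>2 / (1 + 1) + (u k (-1) (-1))\<^sup>2 / (1 + 1)"
      by (intro tendsto_intros U h) simp_all
    ultimately have "2 * e k \<le> (u k 1 1)\<^sup>2 / (1 + 1) + (u k 1 (-1))\<^sup>2 / (1 + 1)
         + (u k (-1) 1)\<^sup>2 / (1 + 1) + (u k (-1) (-1))\<^sup>2 / (1 + 1)"
      by (intro tendsto_le[OF sequentially_bot])
    also have "\<dots> = 2 * ((d k $ k)\<^sup>2 + (n (k+1) $ (k+2))\<^sup>2 + (n k $ k)\<^sup>2)"
      by (simp add: u_def power2_eq_square field_simps)
    finally show ?thesis by simp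
  qed
  show ?thesis
  proof (rule limit_direction_zero)
    show "n k $ k = 0" for k using n0[of "k+2"] by (simp only: cyclic_index)
    show "d k $ (k+1) = d (k+2) $ (k+2)" for k using dd[of "k+1"] by (simp only: cyclic_index)
  qed (use p1 p0 n2 pn d2 quad in \<open>simp_all add: e_def\<close>)
qed

text \<open>
  Rigidity up to rotation, stated through deviations that near \<^term>\<open>O6\<close> vanish exactly on its rotated copies. The radius
  \<open>\<epsilon>\<close> comes from compactness and is not explicit.
\<close>
lemma unit_apart_rigid:
  "\<exists>\<epsilon>>0. \<forall>A B P N. paired_frames A B P N \<longrightarrow> unit_apart A B P N \<longrightarrow>
     (\<forall>k. norm (A (k+1) - axis (k+2) 1) < \<epsilon> \<and> norm (B k - axis (k+2) 1) < \<epsilon> \<and>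
          norm (P k) < \<epsilon> \<and> norm (N k) < \<epsilon>) \<longrightarrow>
     (\<forall>k. P k = 0 \<and> N k = 0 \<and> A (k+1) = B k)"
proof (rule ccontr)
  assume neg: "\<not> ?thesis"
  have "\<exists>A B P N. paired_frames A B P N \<and> unit_apart A B P N \<and>
     (\<forall>k. norm (A (k+1) - axis (k+2) 1) < inverse (real (Suc i)) \<and>
          norm (B k - axis (k+2) 1) < inverse (real (Suc i)) \<and>
          norm (P k) < inverse (real (Suc i)) \<and> norm (N k) < inverse (real (Suc i))) \<and>
     \<not> (\<forall>k. P k = 0 \<and> N k = 0 \<and> A (k+1) = B k)" for i
  proof -
    have "inverse (real (Suc i)) > 0" by simp
    then show ?thesis using neg by blast
  qed
  then obtain A B P N where frames: "\<And>i. paired_frames (A i) (B i) (P i) (N i)"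
    and apart: "\<And>i. unit_apart (A i) (B i) (P i) (N i)"
    and near: "\<And>i k. norm (A i (k+1) - axis (k+2) 1) < inverse (real (Suc i))"
      "\<And>i k. norm (B i k - axis (k+2) 1) < inverse (real (Suc i))"
      "\<And>i k. norm (P i k) < inverse (real (Suc i))"
      "\<And>i k. norm (N i k) < inverse (real (Suc i))"
    and nonzero: "\<And>i. \<not> (\<forall>k. P i k = 0 \<and> N i k = 0 \<and> A i (k+1) = B i k)"
    by metis
  have null: "v \<longlonglongrightarrow> 0" if "\<And>i. norm (v i) < inverse (real (Suc i))" for v :: "nat \<Rightarrow> real^3"
    by (rule Lim_null_comparison[OF _ LIMSEQ_inverse_real_of_nat])
      (intro always_eventually allI less_imp_le that)
  have A: "(\<lambda>i. A i (k+1)) \<longlonglongrightarrow> axis (k+2) 1" and B: "(\<lambda>i. B i k) \<longlonglongrightarrow> axis (k+2) 1"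
    and P: "(\<lambda>i. P i k) \<longlonglongrightarrow> 0" and N: "(\<lambda>i. N i k) \<longlonglongrightarrow> 0" for k
    by (subst Lim_null, rule null, rule near) (subst Lim_null, rule null, rule near,
      rule null, rule near, rule null, rule near)
  define Z where "Z i = (\<chi> k. P i k, \<chi> k. N i k, \<chi> k. A i (k+1) - B i k)" for i
  define r where "r i = norm (Z i)" for i
  have r_pos: "r i > 0" for i
    using nonzero[of i] by (auto simp: r_def Z_def vec_eq_iff prod_eq_iff)
  have "Z \<longlonglongrightarrow> (\<chi> k. 0, \<chi> k. 0, \<chi> k. axis (k+2) 1 - axis (k+2) 1)"
    unfolding Z_def by (intro tendsto_intros A B P N)
  then have "r \<longlonglongrightarrow> norm ((\<chi> k. 0, \<chi> k. 0, \<chi> k. axis (k+2) 1 - axis (k+2) 1) :: (real^3^3) \<times> (real^3^3) \<times> (real^3^3))"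
    unfolding r_def by (rule tendsto_norm)
  also have "(\<chi> k. 0, \<chi> k. 0, \<chi> k. axis (k+2) 1 - axis (k+2) 1) = (0 :: (real^3^3) \<times> (real^3^3) \<times> (real^3^3))"
    by (simp add: prod_eq_iff vec_eq_iff)
  finally have r: "r \<longlonglongrightarrow> 0" by simp
  \<comment> \<open>The rescaled deviations lie on a compact sphere; a limit point of them is a unit vector,
      which \<open>blow_up_limit_zero\<close> rules out.\<close>
  define Y where "Y i = Z i /\<^sub>R r i" for i
  have "Y i \<in> sphere 0 1" for i
    using r_pos[of i] by (simp add: Y_def r_def)
  then obtain l \<phi> where l: "l \<in> sphere 0 1" and \<phi>: "strict_mono \<phi>" and Yl: "(Y \<circ> \<phi>) \<longlonglongrightarrow> l"
    using compact_sphere[unfolded compact_def, rule_format, of Y 0 1] by blast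
  have sub: "(\<lambda>i. v (\<phi> i)) \<longlonglongrightarrow> w" if "v \<longlonglongrightarrow> w" for v :: "nat \<Rightarrow> 'b::topological_space" and w
    using LIMSEQ_subseq_LIMSEQ[OF that \<phi>] by (simp add: o_def)
  have Y: "(\<lambda>i. fst (Y (\<phi> i)) $ k) \<longlonglongrightarrow> fst l $ k"
    "(\<lambda>i. fst (snd (Y (\<phi> i))) $ k) \<longlonglongrightarrow> fst (snd l) $ k"
    "(\<lambda>i. snd (snd (Y (\<phi> i))) $ k) \<longlonglongrightarrow> snd (snd l) $ k" for k
    using Yl unfolding o_def by (intro tendsto_intros; assumption)+
  have unscale: "P i k = r i *\<^sub>R (fst (Y i) $ k)" "N i k = r i *\<^sub>R (fst (snd (Y i)) $ k)"
    "A i (k+1) = B i k + r i *\<^sub>R (snd (snd (Y i)) $ k)" for i k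
    using r_pos[of i] by (simp_all add: Y_def Z_def)
  have "fst l $ k = 0 \<and> fst (snd l) $ k = 0 \<and> snd (snd l) $ k = 0" for k
  proof (rule blow_up_limit_zero)
    show "paired_frames (A (\<phi> i)) (B (\<phi> i)) (\<lambda>k. r (\<phi> i) *\<^sub>R (fst (Y (\<phi> i)) $ k))
        (\<lambda>k. r (\<phi> i) *\<^sub>R (fst (snd (Y (\<phi> i))) $ k))" for i
      using frames[of "\<phi> i"] by (simp add: unscale(1,2)[symmetric])
    show "unit_apart (A (\<phi> i)) (B (\<phi> i)) (\<lambda>k. r (\<phi> i) *\<^sub>R (fst (Y (\<phi> i)) $ k))
        (\<lambda>k. r (\<phi> i) *\<^sub>R (fst (snd (Y (\<phi> i))) $ k))" for i
      using apart[of "\<phi> i"] by (simp add: unscale(1,2)[symmetric])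
    show "A (\<phi> i) (k+1) = B (\<phi> i) k + r (\<phi> i) *\<^sub>R (snd (snd (Y (\<phi> i))) $ k)" for i k
      by (rule unscale(3))
  qed (use r_pos sub[OF r] sub[OF B] Y in simp_all)
  then have "l = 0" by (simp add: prod_eq_iff vec_eq_iff)
  then show False using l by simp
qed

section \<open>The six lines and their distances\<close>

text \<open>
  The positions of \<open>\<ell>\<^sub>k\<^sup>+\<close> (\<open>s = 1\<close>) and \<open>\<ell>\<^sub>k\<^sup>-\<close> (\<open>s = -1\<close>) in the list of six lines. Indexing by \<^typ>\<open>3\<close>, where
  \<open>3 = 0\<close>, makes the cyclic symmetry of \<^term>\<open>O6\<close> visible: \<open>e\<^sub>k\<^sub>+\<^sub>2\<close> is the direction of both lines tangent at \<open>\<plusminus>e\<^sub>k\<close>.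
\<close>
definition line_index :: "3 \<Rightarrow> real \<Rightarrow> nat" where
  "line_index k s = (if k = 1 then 1 else if k = 2 then 3 else 5) + (if s = 1 then 0 else 1)"

lemma line_index_le: "line_index k s \<in> {1..6}"
  by (simp add: line_index_def)

lemma line_index_cases:
  assumes "i \<in> {1..6}"
  obtains k s where "s \<in> {1, -1}" "i = line_index k s"
proof -
  have "i = 1 \<or> i = 2 \<or> i = 3 \<or> i = 4 \<or> i = 5 \<or> i = 6" using assms by auto
  then have "i = line_index 1 1 \<or> i = line_index 1 (-1) \<or> i = line_index 2 1 \<or>
      i = line_index 2 (-1) \<or> i = line_index 3 1 \<or> i = line_index 3 (-1)"
    by (simp add: line_index_def numeral_2_eq_2)
  then show thesis using that by blast
qed

lemma line_index_inject:
  assumes "s \<in> {1, -1}" "t \<in> {1, -1}" "line_index k s = line_index l t"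
  shows "k = l \<and> s = t"
proof -
  have "k \<in> {1, 2, 3}" "l \<in> {1, 2, 3}" using exhaust_3 by auto
  then show ?thesis
    using assms by (elim insertE emptyE; simp add: line_index_def)
qed

lemma O6_line_index:
  assumes "s \<in> {1, -1}"
  shows "O6 (line_index k s) = line_of (s *\<^sub>R axis k 1, axis (k+2) 1)"
proof -
  have num: "(4::3) = 1" "(5::3) = 2" by simp_all
  show ?thesis
    using assms exhaust_3[of k]
    by (auto simp: O6_def line_index_def num simp del: line_of.simps)
qed

lemma finite_pair_distances:
  "finite {setdist (m i) (m j) | i j. 1 \<le> i \<and> i < j \<and> j \<le> (6::nat)}"
proof -
  have "{setdist (m i) (m j) | i j. 1 \<le> i \<and> i < j \<and> j \<le> (6::nat)}
      \<subseteq> (\<lambda>(i, j). setdist (m i) (m j)) ` ({..6} \<times> {..6})" by auto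
  then show ?thesis by (rule finite_subset) simp
qed

lemma D_le_setdist:
  assumes "i \<in> {1..6}" "j \<in> {1..6}" "i \<noteq> j"
  shows "D m \<le> setdist (m i) (m j)"
proof -
  have "D m \<le> setdist (m i) (m j)" if "1 \<le> i" "i < j" "j \<le> 6" for i j
    unfolding D_def using that by (intro Min_le finite_pair_distances) auto
  from this[of i j] this[of j i] show ?thesis
    using assms by (auto simp: setdist_sym neq_iff)
qed

lemma D_O6_ge_1: "1 \<le> D O6"
proof -
  have *: "1 \<le> setdist (line_of (s *\<^sub>R axis k 1, axis (k+2) 1)) (line_of (t *\<^sub>R axis l 1, axis (l+2) 1))"
    if "s \<in> {1,-1}" "t \<in> {1,-1}" and distinct: "k \<noteq> l \<or> s \<noteq> t" for k l :: 3 and s t :: real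
  proof (rule le_setdistI)
    note signs = that(1,2)
    fix p q assume "p \<in> line_of (s *\<^sub>R axis k 1, axis (k+2) (1::real))"
      and "q \<in> line_of (t *\<^sub>R axis l 1, axis (l+2) (1::real))"
    then obtain a b where p: "p = s *\<^sub>R axis k 1 + a *\<^sub>R axis (k+2) 1"
      and q: "q = t *\<^sub>R axis l 1 + b *\<^sub>R axis (l+2) 1" by auto
    have "l = k \<or> l = k + 1 \<or> l = k + 2"
      using exhaust_3[of k] exhaust_3[of l] by auto
    moreover have "k = l + 1" if "l = k + 2" by (simp only: that cyclic_index)
    ultimately consider "l = k" "s \<noteq> t" | "l = k + 1" | "k = l + 1"
      using distinct by blast
    \<comment> \<open>Some common perpendicular of the two lines is a coordinate axis, so one coordinate of \<open>p - q\<close> is already large.\<close>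
    then obtain j where "1 \<le> \<bar>(p - q) $ j\<bar>"
    proof cases
      case 1
      then have "\<bar>(p - q) $ k\<bar> = 2" using signs by (auto simp: p q axis_def)
      then show ?thesis using that[of k] by simp
    next
      case 2
      then have "\<bar>(p - q) $ (k+1)\<bar> = 1" using signs by (auto simp: p q axis_def)
      then show ?thesis using that[of "k+1"] by simp
    next
      case 3
      then have "\<bar>(p - q) $ (l+1)\<bar> = 1" using signs by (auto simp: p q axis_def)
      then show ?thesis using that[of "l+1"] by simp
    qed
    also have "\<dots> \<le> dist p q" by (simp only: dist_norm component_le_norm_cart)
    finally show "1 \<le> dist p q" .
  qed auto
  have "1 \<le> setdist (O6 i) (O6 j)" if "1 \<le> i" "i < j" "j \<le> 6" for i j
  proof -
    have "i \<in> {1..6}" "j \<in> {1..6}" using that by auto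
    then obtain k s l t where i: "s \<in> {1,-1}" "i = line_index k s"
      and j: "t \<in> {1,-1}" "j = line_index l t"
      using line_index_cases by metis
    show ?thesis
      unfolding i(2) j(2) O6_line_index[OF i(1)] O6_line_index[OF j(1)]
      by (rule *[OF i(1) j(1)]) (use that i j in auto)
  qed
  moreover have "setdist (O6 1) (O6 2) \<in> {setdist (O6 i) (O6 j) | i j. 1 \<le> i \<and> i < j \<and> j \<le> 6}"
    by force
  ultimately show ?thesis
    unfolding D_def by (subst Min_ge_iff) (use finite_pair_distances in blast)+
qed

section \<open>Rotated copies of the configuration\<close>

lemma line_of_matrix_image:
  "(\<lambda>p. g *v p) ` line_of (x, \<xi>) = line_of (g *v x, g *v \<xi>)"
  by (simp add: image_image matrix_vector_right_distrib matrix_vector_mult_scaleR)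

lemma axis_cross_3: "cross3 (axis (k+1) 1) (axis (k+2) 1) = axis k 1"
proof -
  have num: "(4::3) = 1" "(5::3) = 2" by simp_all
  show ?thesis using exhaust_3[of k] by (auto simp: cross_basis num)
qed

text \<open>
  The matrix \<open>g\<close> with columns \<open>B (j+1)\<close> is orthogonal and maps the directions correctly. The points of tangency
  are cross products of directions, so they are mapped correctly if \<open>g\<close> preserves orientation; nearness to \<^term>\<open>O6\<close> decides this.
\<close>
lemma rigid_frames_imp_rotation:
  fixes x :: "3 \<Rightarrow> real \<Rightarrow> real^3" and B :: "3 \<Rightarrow> real^3"
  assumes x: "\<And>k s. s \<in> {1,-1} \<Longrightarrow> x k s = - s *\<^sub>R cross3 (B k) (B (k+2))"
    and orthonormal: "\<And>k. B k \<bullet> B k = 1" "\<And>k. B k \<bullet> B (k+1) = 0"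
    and near: "\<And>k. norm (x k 1 - axis k 1) < 1" "\<And>k. norm (B (k+1) - axis k 1) < 1"
  obtains g where "rotation_matrix g" "\<And>k. g *v axis (k+2) 1 = B k"
    "\<And>k s. s \<in> {1,-1} \<Longrightarrow> g *v (s *\<^sub>R axis k 1) = x k s"
proof -
  define g :: "real^3^3" where "g = (\<chi> i j. B (j+1) $ i)"
  have col: "column j g = B (j+1)" for j
    by (simp add: g_def column_def vec_eq_iff)
  have g_axis: "g *v axis j 1 = B (j+1)" for j
    by (simp add: matrix_vector_mul_component vec_eq_iff col[symmetric] matrix_vector_mult_basis)
  have gB: "g *v axis (k+2) 1 = B k" for k
    using g_axis[of "k+2"] by (simp only: cyclic_index)
  have orth: "B k \<bullet> B l = 0" if "k \<noteq> l" for k l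
  proof -
    have "l = k + 1 \<or> k = l + 1"
      using that exhaust_3[of k] exhaust_3[of l] by auto
    then show ?thesis using orthonormal(2)[of k] orthonormal(2)[of l] by (auto simp: inner_commute)
  qed
  have "orthogonal_matrix g"
    unfolding orthogonal_matrix_orthonormal_columns col
    using orthonormal(1) orth by (auto simp: orthogonal_def norm_eq_1)
  \<comment> \<open>A rotoinversion would send \<open>e\<^sub>1\<close> to \<open>- x 1 1\<close>, but both \<open>B (1+1)\<close> and \<open>x 1 1\<close> are near \<open>e\<^sub>1\<close>.\<close>
  moreover have "\<not> rotoinversion_matrix g"
  proof
    assume "rotoinversion_matrix g"
    moreover have "- g *v v = - (g *v v)" for v
      by (simp add: matrix_vector_mult_def sum_negf vec_eq_iff)
    ultimately have "cross3 (g *v axis (k+1) 1) (g *v axis (k+2) 1) = - (g *v axis k 1)" for k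
      by (simp only: cross_rotoinversion_matrix axis_cross_3)
    then have "cross3 (B (k+2)) (B k) = - B (k+1)" for k
      by (simp only: gB g_axis cyclic_index)
    then have "cross3 (B k) (B (k+2)) = B (k+1)" for k
      by (subst cross_skew) (simp only: minus_minus)
    then have "x k 1 = - B (k+1)" for k
      using x[of 1 k] by simp
    then have "2 *\<^sub>R axis 1 1 = - ((x 1 1 - axis 1 1) + (B (1+1) - axis 1 1))"
      by (simp add: scaleR_2)
    then have "norm (2 *\<^sub>R axis 1 1 :: real^3) = norm ((x 1 1 - axis 1 1) + (B (1+1) - axis 1 1))"
      by (simp only: norm_minus_cancel)
    also have "\<dots> < 1 + 1"
      by (rule norm_add_less[OF near])
    finally show False by (simp add: norm_axis_1)
  qed
  ultimately have rot: "rotation_matrix g"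
    using orthogonal_rotation_or_rotoinversion by blast
  have "g *v (s *\<^sub>R axis k 1) = x k s" if "s \<in> {1,-1}" for k s
  proof -
    have "g *v axis k 1 = cross3 (g *v axis (k+1) 1) (g *v axis (k+2) 1)"
      by (simp add: cross_rotation_matrix[OF rot] axis_cross_3)
    also have "\<dots> = cross3 (B (k+2)) (B k)"
      by (simp only: gB g_axis cyclic_index)
    also have "\<dots> = - cross3 (B k) (B (k+2))" by (rule cross_skew)
    finally show ?thesis using x[OF that] by (simp add: matrix_vector_mult_scaleR)
  qed
  with rot gB show thesis by (rule that)
qed

section \<open>Neighbourhoods of the configuration\<close>

lemma openin_M_line_nbhd:
  "openin M {line_of (x, \<xi>) |x \<xi>. (x, \<xi>) \<in> unit_tangent_bundle \<and> norm (x - x0) < \<epsilon> \<and> norm (\<xi> - \<xi>0) < \<epsilon>}"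
    (is "openin M ?U")
proof -
  have minus: "(x, - \<xi>) \<in> unit_tangent_bundle \<longleftrightarrow> (x, \<xi>) \<in> unit_tangent_bundle" for x \<xi>
    by (simp add: unit_tangent_bundle_def)
  \<comment> \<open>A line is the image of \<open>(x, \<xi>)\<close> and of \<open>(x, - \<xi>)\<close>, so the preimage consists of two pieces exchanged by \<open>\<xi> \<mapsto> - \<xi>\<close>.\<close>
  have "{p \<in> unit_tangent_bundle. line_of p \<in> ?U} = unit_tangent_bundle \<inter>
      {p. norm (fst p - x0) < \<epsilon> \<and> (norm (snd p - \<xi>0) < \<epsilon> \<or> norm (- snd p - \<xi>0) < \<epsilon>)}"
    (is "?L = ?R")
  proof (intro set_eqI iffI)
    fix p assume "p \<in> ?L"
    moreover obtain x \<xi> where p: "p = (x, \<xi>)" by fastforce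
    ultimately obtain y \<eta> where y: "(y, \<eta>) \<in> unit_tangent_bundle" "norm (y - x0) < \<epsilon>" "norm (\<eta> - \<xi>0) < \<epsilon>"
      and x: "(x, \<xi>) \<in> unit_tangent_bundle" and eq: "line_of (x, \<xi>) = line_of (y, \<eta>)"
      by blast
    show "p \<in> ?R" using y x eq[unfolded line_of_eq_iff[OF x y(1)]] p by auto
  next
    fix p assume "p \<in> ?R"
    moreover obtain x \<xi> where p: "p = (x, \<xi>)" by fastforce
    ultimately have x: "(x, \<xi>) \<in> unit_tangent_bundle" "norm (x - x0) < \<epsilon>"
      and or: "norm (\<xi> - \<xi>0) < \<epsilon> \<or> norm (- \<xi> - \<xi>0) < \<epsilon>" by auto
    have "line_of (x, \<xi>) = line_of (x, - \<xi>)"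
      using x by (subst line_of_eq_iff) (simp_all add: minus)
    then have "line_of (x, \<xi>) \<in> ?U" using x or minus by blast
    then show "p \<in> ?L" using x p by simp
  qed
  moreover have "open {p :: (real^3) \<times> (real^3). norm (fst p - x0) < \<epsilon> \<and>
      (norm (snd p - \<xi>0) < \<epsilon> \<or> norm (- snd p - \<xi>0) < \<epsilon>)}"
    by (intro open_Collect_conj open_Collect_disj open_Collect_less continuous_intros)
  moreover have "?U \<subseteq> tangent_lines"
    by (auto simp: tangent_lines_def simp del: line_of.simps)
  ultimately show ?thesis
    unfolding openin_M by (auto simp: openin_open)
qed

lemma norm_cross3_diff_le:
  assumes "norm x \<le> 1" "norm \<xi>0 \<le> 1"
  shows "norm (cross3 x \<xi> - cross3 x0 \<xi>0) \<le> norm (x - x0) + norm (\<xi> - \<xi>0)"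
proof -
  have le: "norm (cross3 a b) \<le> norm a * norm b" for a b :: "real^3"
  proof (rule power2_le_imp_le)
    show "(norm (cross3 a b))\<^sup>2 \<le> (norm a * norm b)\<^sup>2"
      unfolding norm_cross_dot[of a b, symmetric] by simp
  qed simp
  have "cross3 x \<xi> - cross3 x0 \<xi>0 = cross3 x (\<xi> - \<xi>0) + cross3 (x - x0) \<xi>0"
    by (simp add: Cross3.left_diff_distrib Cross3.right_diff_distrib)
  also have "norm \<dots> \<le> norm x * norm (\<xi> - \<xi>0) + norm (x - x0) * norm \<xi>0"
    by (intro norm_triangle_mono le)
  also have "\<dots> \<le> 1 * norm (\<xi> - \<xi>0) + norm (x - x0) * 1"
    using assms by (intro add_mono mult_mono) auto
  finally show ?thesis by simp
qed

lemma norm_half_sum_less: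
  fixes a b :: "'a::real_normed_vector"
  assumes "norm a < \<delta>" "norm b < \<delta>"
  shows "norm ((1/2) *\<^sub>R (a + b)) < \<delta>" "norm ((1/2) *\<^sub>R (a - b)) < \<delta>"
proof -
  have "norm (a + b) < 2 * \<delta>" "norm (a - b) < 2 * \<delta>"
    using norm_triangle_ineq[of a b] norm_triangle_ineq4[of a b] assms by linarith+
  then show "norm ((1/2) *\<^sub>R (a + b)) < \<delta>" "norm ((1/2) *\<^sub>R (a - b)) < \<delta>"
    by simp_all
qed

theorem corollary2:
  shows "\<exists>W. openin M6 W \<and> O6 \<in> W \<and>
    (\<forall>m\<in>W. (\<nexists>g. rotation_matrix g \<and> m = rotate6 g O6) \<longrightarrow> D m < D O6)"
proof -
  obtain \<epsilon> where "\<epsilon> > 0" and rigid: "\<And>A B P N. paired_frames A B P N \<Longrightarrow> unit_apart A B P N \<Longrightarrow>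
     (\<And>k. norm (A (k+1) - axis (k+2) 1) < \<epsilon> \<and> norm (B k - axis (k+2) 1) < \<epsilon> \<and>
          norm (P k) < \<epsilon> \<and> norm (N k) < \<epsilon>) \<Longrightarrow>
     (\<forall>k. P k = 0 \<and> N k = 0 \<and> A (k+1) = B k)"
    using unit_apart_rigid by blast
  define \<delta> where "\<delta> = min 1 (\<epsilon> / 2)"
  have \<delta>: "0 < \<delta>" "\<delta> \<le> 1" "2 * \<delta> \<le> \<epsilon>" using \<open>\<epsilon> > 0\<close> by (auto simp: \<delta>_def)
  have axes_utb: "(s *\<^sub>R axis k 1, axis (k+2) 1) \<in> unit_tangent_bundle" if "s \<in> {1,-1}" for s and k :: 3
    using that by (auto simp: unit_tangent_bundle_def inner_axis_axis norm_axis_1)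
  \<comment> \<open>\<open>W\<close> is a product of basic neighbourhoods; the intersection over \<open>k, s\<close> has a single member and
      only transports \<open>V\<close> from pairs \<open>(k, s)\<close> to indices \<open>i\<close>.\<close>
  define V where "V k s = {line_of (x, \<xi>) |x \<xi>. (x, \<xi>) \<in> unit_tangent_bundle \<and>
      norm (x - s *\<^sub>R axis k 1) < \<delta> \<and> norm (\<xi> - axis (k+2) 1) < \<delta>}" for k s
  define W where "W = (\<Pi>\<^sub>E i\<in>{1..6}. \<Inter>{V k s |k s. s \<in> {1,-1} \<and> line_index k s = i})"
  have V_index: "\<Inter>{V l t |l t. t \<in> {1,-1} \<and> line_index l t = line_index k s} = V k s"
    if "s \<in> {1,-1}" for k s
  proof -
    have "{V l t |l t. t \<in> {1,-1} \<and> line_index l t = line_index k s} = {V k s}"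
    proof (intro equalityI subsetI)
      fix X assume "X \<in> {V l t |l t. t \<in> {1,-1} \<and> line_index l t = line_index k s}"
      then obtain l t where X: "X = V l t" and "t \<in> {1,-1}" "line_index l t = line_index k s"
        by (elim CollectE exE conjE)
      then have "l = k \<and> t = s" using line_index_inject[OF _ that] by metis
      then show "X \<in> {V k s}" using X by simp
    qed (use that in blast)
    then show ?thesis by simp
  qed
  have "openin M6 W"
    unfolding M6_def W_def
  proof (rule openin_PiE[THEN iffD2, OF _ disjI2], simp, rule ballI)
    fix i :: nat assume "i \<in> {1..6}"
    then obtain k s where s: "s \<in> {1,-1}" and i: "i = line_index k s" by (rule line_index_cases)
    show "openin M (\<Inter>{V k s |k s. s \<in> {1,-1} \<and> line_index k s = i})"
      unfolding i V_index[OF s] unfolding V_def by (rule openin_M_line_nbhd)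
  qed
  moreover have "O6 \<in> W"
    unfolding W_def
  proof (rule PiE_I)
    fix i :: nat assume "i \<in> {1..6}"
    then obtain k s where s: "s \<in> {1,-1}" and i: "i = line_index k s" by (rule line_index_cases)
    have "O6 i \<in> V k s"
      unfolding i O6_line_index[OF s] V_def using axes_utb[OF s, of k] \<delta>(1)
      by (intro CollectI exI[of _ "s *\<^sub>R axis k 1"] exI[of _ "axis (k+2) 1"]) (simp del: line_of.simps)
    then show "O6 i \<in> \<Inter>{V k s |k s. s \<in> {1,-1} \<and> line_index k s = i}"
      unfolding i V_index[OF s] .
  qed (simp add: O6_def del: line_of.simps atLeastAtMost_iff)
  moreover have "\<exists>g. rotation_matrix g \<and> m = rotate6 g O6" if m: "m \<in> W" and Dm: "D O6 \<le> D m" for m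
  proof -
    have apart: "1 \<le> setdist (m (line_index k s)) (m (line_index (k+1) t))"
      if "s \<in> {1,-1}" "t \<in> {1,-1}" for k s t
    proof -
      have "line_index k s \<noteq> line_index (k+1) t"
        using line_index_inject[OF that, of k "k+1"] by auto
      then have "D m \<le> setdist (m (line_index k s)) (m (line_index (k+1) t))"
        by (intro D_le_setdist line_index_le)
      then show ?thesis using D_O6_ge_1 Dm by linarith
    qed
    have mV: "m (line_index k s) \<in> V k s" if "s \<in> {1,-1}" for k s
      using PiE_mem[OF m[unfolded W_def] line_index_le[of k s]] unfolding V_index[OF that] .
    define rep where "rep k s = (SOME p. m (line_index k s) = line_of p \<and> p \<in> unit_tangent_bundle \<and>
        norm (fst p - s *\<^sub>R axis k 1) < \<delta> \<and> norm (snd p - axis (k+2) 1) < \<delta>)" for k s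
    have rep: "m (line_index k s) = line_of (rep k s) \<and> rep k s \<in> unit_tangent_bundle \<and>
        norm (fst (rep k s) - s *\<^sub>R axis k 1) < \<delta> \<and> norm (snd (rep k s) - axis (k+2) 1) < \<delta>"
      if "s \<in> {1,-1}" for k s
      unfolding rep_def
    proof (rule someI_ex)
      from mV[OF that, of k] obtain x \<xi> where "m (line_index k s) = line_of (x, \<xi>)"
        "(x, \<xi>) \<in> unit_tangent_bundle" "norm (x - s *\<^sub>R axis k 1) < \<delta>" "norm (\<xi> - axis (k+2) 1) < \<delta>"
        unfolding V_def by (elim CollectE exE conjE)
      then show "\<exists>p. m (line_index k s) = line_of p \<and> p \<in> unit_tangent_bundle \<and>
          norm (fst p - s *\<^sub>R axis k 1) < \<delta> \<and> norm (snd p - axis (k+2) 1) < \<delta>"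
        by (intro exI[of _ "(x, \<xi>)"]) (simp del: line_of.simps)
    qed
    define x where "x k s = fst (rep k s)" for k s
    define \<xi> where "\<xi> k s = snd (rep k s)" for k s
    have line: "m (line_index k s) = line_of (x k s, \<xi> k s)"
      and utb: "(x k s, \<xi> k s) \<in> unit_tangent_bundle"
      and x_near: "norm (x k s - s *\<^sub>R axis k 1) < \<delta>"
      and \<xi>_near: "norm (\<xi> k s - axis (k+2) 1) < \<delta>" if "s \<in> {1,-1}" for k s
      using rep[OF that, of k] by (simp_all add: x_def \<xi>_def del: line_of.simps)
    define \<mu> where "\<mu> k s = cross3 (x k s) (\<xi> k s)" for k s
    have \<mu>_near: "norm (\<mu> k s + s *\<^sub>R axis (k+1) 1) < \<epsilon>" if "s \<in> {1,-1}" for k s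
    proof -
      have "cross3 (axis k 1) (axis (k+2) 1) = - (axis (k+1) 1 :: real^3)"
        using axis_cross_3[of "k+1"] cross_skew[of "axis k 1" "axis (k+2) 1"] by (simp only: cyclic_index)
      then have "\<mu> k s + s *\<^sub>R axis (k+1) 1
          = cross3 (x k s) (\<xi> k s) - cross3 (s *\<^sub>R axis k 1) (axis (k+2) 1)"
        by (simp add: \<mu>_def cross_mult_left)
      then have "norm (\<mu> k s + s *\<^sub>R axis (k+1) 1)
          \<le> norm (x k s - s *\<^sub>R axis k 1) + norm (\<xi> k s - axis (k+2) 1)"
        using norm_cross3_diff_le utb[OF that, of k]
        by (simp add: unit_tangent_bundle_def norm_axis_1)
      then show ?thesis using x_near[OF that, of k] \<xi>_near[OF that, of k] \<delta>(3) by linarith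
    qed
    define A where "A k = (1/2) *\<^sub>R (\<mu> k (-1) - \<mu> k 1)" for k
    define B where "B k = (1/2) *\<^sub>R (\<xi> k 1 + \<xi> k (-1))" for k
    define P where "P k = (1/2) *\<^sub>R (\<mu> k 1 + \<mu> k (-1))" for k
    define N where "N k = (1/2) *\<^sub>R (\<xi> k 1 - \<xi> k (-1))" for k
    have frames: "paired_frames A B P N"
      unfolding A_def B_def P_def N_def by (rule paired_frames_from_lines[OF utb \<mu>_def])
    have "unit_apart A B P N"
      unfolding A_def B_def P_def N_def
      by (rule unit_apart_from_lines[OF utb \<mu>_def]) (use apart line in \<open>simp_all del: line_of.simps\<close>)
    \<comment> \<open>These express the half sums and half differences through the deviations from a basis vector \<open>c\<close>.\<close>
    have half: "(1/2) *\<^sub>R (a + b) - c = (1/2) *\<^sub>R ((a - c) + (b - c))"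
      "(1/2) *\<^sub>R (a - b) - c = (1/2) *\<^sub>R ((a - c) - (b + c))"
      "(1/2) *\<^sub>R (a - b) = (1/2) *\<^sub>R ((a - c) - (b - c))"
      "(1/2) *\<^sub>R (a + b) = (1/2) *\<^sub>R ((a + c) + (b - c))" for a b c :: "real^3"
      by (simp_all add: vec_eq_iff field_simps)
    have \<mu>1: "norm (\<mu> k 1 + axis (k+1) 1) < \<epsilon>" "norm (\<mu> k (-1) - axis (k+1) 1) < \<epsilon>" for k
      using \<mu>_near[of 1 k] \<mu>_near[of "-1" k] by simp_all
    \<comment> \<open>Near \<open>O6\<close> the vectors \<open>\<mu> k 1\<close> and \<open>\<mu> k (-1)\<close> are nearly opposite and \<open>\<xi> k 1\<close>, \<open>\<xi> k (-1)\<close> nearly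
        equal, so the differences and sums below are close to basis vectors or to zero.\<close>
    have A_near: "norm (A k - axis (k+1) 1) < \<epsilon>" for k
      unfolding A_def by (subst half(2)) (rule norm_half_sum_less(2)[OF \<mu>1(2,1)])
    have P_near: "norm (P k) < \<epsilon>" for k
      unfolding P_def
      by (subst half(4)[where c = "axis (k+1) 1"]) (rule norm_half_sum_less(1)[OF \<mu>1(1,2)])
    have B_near: "norm (B k - axis (k+2) 1) < \<delta>" for k
      unfolding B_def by (subst half(1)) (intro norm_half_sum_less(1) \<xi>_near; simp)
    have N_near: "norm (N k) < \<delta>" for k
      unfolding N_def
      by (subst half(3)[where c = "axis (k+2) 1"]) (intro norm_half_sum_less(2) \<xi>_near; simp)
    have "\<delta> \<le> \<epsilon>" using \<delta> by linarith
    \<comment> \<open>Rigidity makes the lines of each pair exactly parallel and opposite; it remains to find the rotation.\<close>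
    have eq: "P k = 0 \<and> N k = 0 \<and> A (k+1) = B k" for k
    proof (rule rigid[OF frames \<open>unit_apart A B P N\<close>, rule_format])
      show "norm (A (k+1) - axis (k+2) 1) < \<epsilon> \<and> norm (B k - axis (k+2) 1) < \<epsilon> \<and>
          norm (P k) < \<epsilon> \<and> norm (N k) < \<epsilon>" for k
        using A_near[of "k+1"] P_near[of k] B_near[of k] N_near[of k] \<open>\<delta> \<le> \<epsilon>\<close>
        unfolding cyclic_index by simp
    qed
    have A_eq: "A k = B (k+2)" for k
      using eq[of "k+2"] by (simp only: cyclic_index)
    have \<xi>_eq: "\<xi> k s = B k" and \<mu>_eq: "\<mu> k s = - s *\<^sub>R B (k+2)" if "s \<in> {1,-1}" for k s
    proof -
      have "\<xi> k 1 = \<xi> k (-1)" using eq[of k] by (simp add: N_def)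
      then show "\<xi> k s = B k" using that by (auto simp: B_def scaleR_2[symmetric])
      have "\<mu> k 1 = - \<mu> k (-1)" using eq[of k] by (simp add: P_def eq_neg_iff_add_eq_0)
      then show "\<mu> k s = - s *\<^sub>R B (k+2)"
        using that unfolding A_eq[symmetric] by (auto simp: A_def scaleR_2[symmetric])
    qed
    have BB: "B k \<bullet> B k = 1" for k
    proof -
      have "B k \<bullet> B k + N k \<bullet> N k = 1" using frames unfolding paired_frames_def by blast
      then show ?thesis using eq[of k] by simp
    qed
    have AB_orth: "A (k+1) \<bullet> B (k+1) = 0" for k
    proof -
      have "P (k+1) \<bullet> N (k+1) = A (k+1) \<bullet> B (k+1)"
        using frames unfolding paired_frames_def by blast
      then show ?thesis using eq[of "k+1"] by simp
    qed
    have B_orth: "B k \<bullet> B (k+1) = 0" for k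
      using AB_orth[of k] eq[of k] by simp
    have x_eq: "x k s = - s *\<^sub>R cross3 (B k) (B (k+2))" if "s \<in> {1,-1}" for k s
    proof -
      have "x k s = cross3 (\<xi> k s) (\<mu> k s)"
        using utb[OF that, of k]
        by (simp add: \<mu>_def Lagrange unit_tangent_bundle_def norm_eq_1 inner_commute)
      then show ?thesis by (simp add: \<xi>_eq[OF that] \<mu>_eq[OF that] cross_mult_right)
    qed
    have "norm (x k 1 - axis k 1) < 1" "norm (B (k+1) - axis k 1) < 1" for k
      using x_near[of 1 k] B_near[of "k+1"] \<delta>(2) unfolding cyclic_index by simp_all
    from rigid_frames_imp_rotation[OF x_eq BB B_orth this]
    obtain g where rot: "rotation_matrix g" and g\<xi>: "\<And>k. g *v axis (k+2) 1 = B k"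
      and gx: "\<And>k s. s \<in> {1,-1} \<Longrightarrow> g *v (s *\<^sub>R axis k 1) = x k s" by blast
    have "m = rotate6 g O6"
    proof (rule extensionalityI[where A = "{1..6}"])
      show "m \<in> extensional {1..6}" using m by (simp add: W_def PiE_def)
      show "rotate6 g O6 \<in> extensional {1..6}" by (simp add: rotate6_def)
      fix i :: nat assume i6: "i \<in> {1..6}"
      then obtain k s where s: "s \<in> {1,-1}" and i: "i = line_index k s" by (rule line_index_cases)
      have "rotate6 g O6 i = (\<lambda>p. g *v p) ` O6 i" using i6 by (simp add: rotate6_def)
      also have "\<dots> = line_of (x k s, \<xi> k s)"
        unfolding i O6_line_index[OF s] line_of_matrix_image gx[OF s] g\<xi> \<xi>_eq[OF s] ..
      finally show "m i = rotate6 g O6 i" unfolding i line[OF s] by simp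
    qed
    then show ?thesis using rot by blast
  qed
  ultimately show ?thesis by (meson not_less)
qed

end
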